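(* Let $\mathbf U_K^\star\in[\mathbb P^k(K)]^8$ respect the magnetic constraint and have cell average $\mathbf W_K:=\overline{\mathbf U}_K^\star$, and let $\mathcal B_{K,r}\in\mathbb R$ ($1\le r\le M$) be such that $$\mathbf W_K\in\mathcal G,\qquad\eta_r(\mathbf W_K)\le\mathcal B_{K,r},\quad1\le r\le M .$$ Let $0<\epsilon_{\rho,K}<\rho(\mathbf W_K)$ and $0<\epsilon_{p,K}<p(\mathbf W_K)$, and let $$\mathbf U_K^{\rm new}:=\mathbf W_K+\theta_K(\mathbf U_K^\star-\mathbf W_K),\qquad\theta_K:=\theta_K^{\rm PP}\vartheta_K,$$ with $\theta_K^{\rm PP}$ and $\vartheta_K$ defined in the context. Then $\overline{\mathbf U}_K^{\rm new}=\mathbf W_K$; $\mathbf U_K^{\rm new}(\mathbf x)\in\mathcal G_{K,\epsilon}$ for all $\mathbf x\in\mathcal X_K$; and $$\mathcal S_{K,r}(\mathbf U_K^{\rm new})\le\mathcal B_{K,r},\qquad1\le r\le M .$$ Furthermore, $\mathbf U_K^{\rm new}$ respects the magnetic constraint: $B_{1,K}^{\rm new}\equiv B_{\rm const}$ for $d=1$, and $\sum_{i=1}^d\partial_{x_i}B_{i,K}^{\rm new}=0$ in $K$ for $d\in\{2,3\}$. All these conclusions remain valid if $\theta_K$ is replaced by any smaller nonnegative scalar.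
   Context: **States and entropies.** Fix $\gamma>1$, $d\in\{1,2,3\}$. A state is $\mathbf U=(\rho,\mathbf m^\top,\mathbf B^\top,E)^\top\in\mathbb R^8$ with $\mathbf m,\mathbf B\in\mathbb R^3$; $p=(\gamma-1)(E-\frac{|\mathbf m|^2}{2\rho}-\frac{|\mathbf B|^2}{2})$; $\mathcal G=\{\mathbf U:\rho>0,\ E-\frac{|\mathbf m|^2}{2\rho}-\frac{|\mathbf B|^2}{2}>0\}$. Let $f_1,\dots,f_M\in C^2(\mathbb R)$ satisfy $f_r'>0$, $f_r'-\gamma f_r''>0$ on $\mathbb R$; with $s=\log p-\gamma\log\rho$, $\eta_r(\mathbf U)=-\rho f_r(s)$ on $\mathcal G$. **Cell and quadrature.** $K$ is a bounded interval ($d=1$) or a bounded polytope in $\mathbb R^d$ with nonempty interior ($d\in\{2,3\}$); $\mathbb P^k(K)$ is the space of polynomials of total degree $\le k$, $k\ge0$. A quadrature with finitely many nodes $\mathbf x_{K,a}\in K$ and weights $\omega_{K,a}>0$, $\sum_a\omega_{K,a}=1$, is exact for cell averages: $\overline{\mathbf U}_K=\frac1{|K|}\int_K\mathbf U_K\,d\mathbf x=\sum_a\omega_{K,a}\mathbf U_K(\mathbf x_{K,a})$ for all $\mathbf U_K\in[\mathbb P^k(K)]^8$. $\mathcal X_K\subset K$ is a finite set containing all nodes $\mathbf x_{K,a}$. When all nodal values lie in $\mathcal G$, $\mathcal S_{K,r}(\mathbf U_K)=\sum_a\omega_{K,a}\eta_r(\mathbf U_K(\mathbf x_{K,a}))$.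 **Magnetic constraint.** For $d=1$: $B_{1,K}\equiv B_{\rm const}$ on $K$, with $B_{\rm const}\in\mathbb R$ a fixed constant. For $d\in\{2,3\}$: $\sum_{i=1}^d\partial_{x_i}B_{i,K}=0$ in $K$. (The point values of $\mathbf U_K^\star$ need not lie in $\mathcal G$.) **Lifting.** $\mathcal G_{K,\epsilon}=\{\mathbf U\in\mathcal G:\rho(\mathbf U)\ge\epsilon_{\rho,K},\ p(\mathbf U)\ge\epsilon_{p,K}\}$. Positivity scaling: $\theta_K^{\rm PP}=\max\{\theta\in[0,1]:\mathbf W_K+\theta(\mathbf U_K^\star(\mathbf x)-\mathbf W_K)\in\mathcal G_{K,\epsilon}\ \forall\mathbf x\in\mathcal X_K\}$, $\mathbf U_K^{\rm PP}=\mathbf W_K+\theta_K^{\rm PP}(\mathbf U_K^\star-\mathbf W_K)$. Entropy scaling: $\Phi_{K,r}(\vartheta)=\mathcal S_{K,r}(\mathbf W_K+\vartheta(\mathbf U_K^{\rm PP}-\mathbf W_K))$, $0\le\vartheta\le1$. If $\Phi_{K,r}(1)\le\mathcal B_{K,r}$ set $\vartheta_{K,r}=1$; if $\Phi_{K,r}(1)>\mathcal B_{K,r}$ let $\vartheta_{K,r}\in[0,1)$ be the (unique) solution of $\Phi_{K,r}(\vartheta_{K,r})=\mathcal B_{K,r}$. Finally $\vartheta_K=\min_{1\le r\le M}\vartheta_{K,r}$. *)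

theory Defs
  imports "HOL-Analysis.Analysis"
begin

(* A state U = (rho, m, B, E); this product is the Euclidean space R^8. *)
type_synonym state = "real \<times> (real^3) \<times> (real^3) \<times> real"

definition mass_density :: "state \<Rightarrow> real"
  where "mass_density U = fst U"

definition momentum :: "state \<Rightarrow> real^3"
  where "momentum U = fst (snd U)"

definition magnetic_field :: "state \<Rightarrow> real^3"
  where "magnetic_field U = fst (snd (snd U))"

definition total_energy :: "state \<Rightarrow> real"
  where "total_energy U = snd (snd (snd U))"

definition internal_energy :: "state \<Rightarrow> real"
  where "internal_energy U =
    total_energy U - (norm (momentum U))\<^sup>2 / (2 * mass_density U) - (norm (magnetic_field U))\<^sup>2 / 2"

definition pressure :: "real \<Rightarrow> state \<Rightarrow> real"
  where "pressure \<gamma> U = (\<gamma> - 1) * internal_energy U"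

definition admissible :: "state set"
  where "admissible = {U. mass_density U > 0 \<and> internal_energy U > 0}"

definition admissible_eps :: "real \<Rightarrow> real \<Rightarrow> real \<Rightarrow> state set"
  where "admissible_eps \<gamma> \<epsilon>\<^sub>\<rho> \<epsilon>\<^sub>p =
    {U \<in> admissible. mass_density U \<ge> \<epsilon>\<^sub>\<rho> \<and> pressure \<gamma> U \<ge> \<epsilon>\<^sub>p}"

definition specific_entropy :: "real \<Rightarrow> state \<Rightarrow> real"
  where "specific_entropy \<gamma> U = ln (pressure \<gamma> U) - \<gamma> * ln (mass_density U)"

(* Meaningful on admissible states only. *)
definition entropy :: "real \<Rightarrow> (real \<Rightarrow> real) \<Rightarrow> state \<Rightarrow> real"
  where "entropy \<gamma> f U = - mass_density U * f (specific_entropy \<gamma> U)"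

definition C2 :: "(real \<Rightarrow> real) \<Rightarrow> bool"
  where "C2 f \<longleftrightarrow> (\<forall>z. f differentiable (at z)) \<and> (\<forall>z. deriv f differentiable (at z))
    \<and> continuous_on UNIV (deriv (deriv f))"

(* Polynomials are functions on the whole space. On a cell with nonempty interior
   a polynomial is determined by its restriction to the cell. *)
definition poly_space :: "nat \<Rightarrow> (real^'d \<Rightarrow> real) set"
  where "poly_space k =
    {q. \<exists>c :: ('d \<Rightarrow> nat) \<Rightarrow> real.
        \<forall>x. q x = (\<Sum>\<alpha> | (\<Sum>i\<in>UNIV. \<alpha> i) \<le> k. c \<alpha> * (\<Prod>i\<in>UNIV. (x $ i) ^ \<alpha> i))}"

definition poly_states :: "nat \<Rightarrow> (real^'d \<Rightarrow> state) set"
  where "poly_states k =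
    {U. (\<lambda>x. mass_density (U x)) \<in> poly_space k
      \<and> (\<forall>i. (\<lambda>x. momentum (U x) $ i) \<in> poly_space k)
      \<and> (\<forall>i. (\<lambda>x. magnetic_field (U x) $ i) \<in> poly_space k)
      \<and> (\<lambda>x. total_energy (U x)) \<in> poly_space k}"

definition is_cell :: "(real^'d) set \<Rightarrow> bool"
  where "is_cell K \<longleftrightarrow>
    (if CARD('d) = 1 then is_interval K \<and> bounded K else polytope K) \<and> interior K \<noteq> {}"

definition cell_average :: "(real^'d) set \<Rightarrow> (real^'d \<Rightarrow> state) \<Rightarrow> state"
  where "cell_average K U = (1 / measure lebesgue K) *\<^sub>R integral K U"

(* The bijection e numbers the coordinates of real^'d: x $ e i is the mathematical x_i,
   for i = 1, ..., d with d = CARD('d). In the type 3, of_nat i is the index i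
   (and 3 = 0), so magnetic_field U $ of_nat i is B_i. *)
definition magnetic_constraint ::
  "(nat \<Rightarrow> 'd) \<Rightarrow> real \<Rightarrow> (real^'d) set \<Rightarrow> (real^'d \<Rightarrow> state) \<Rightarrow> bool"
  where "magnetic_constraint e B\<^sub>0 K U \<longleftrightarrow>
    (if CARD('d) = 1 then (\<forall>x\<in>K. magnetic_field (U x) $ 1 = B\<^sub>0)
     else (\<forall>x\<in>K. (\<Sum>i=1..CARD('d).
        frechet_derivative (\<lambda>y. magnetic_field (U y) $ of_nat i) (at x) (axis (e i) 1)) = 0))"

definition quad_entropy ::
  "real \<Rightarrow> (real \<Rightarrow> real) \<Rightarrow> nat \<Rightarrow> (nat \<Rightarrow> real) \<Rightarrow> (nat \<Rightarrow> real^'d) \<Rightarrow> (real^'d \<Rightarrow> state) \<Rightarrow> real"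
  where "quad_entropy \<gamma> f N \<omega> node U = (\<Sum>a=1..N. \<omega> a * entropy \<gamma> f (U (node a)))"

definition scaled :: "state \<Rightarrow> (real^'d \<Rightarrow> state) \<Rightarrow> real \<Rightarrow> real^'d \<Rightarrow> state"
  where "scaled W U \<theta> = (\<lambda>x. W + \<theta> *\<^sub>R (U x - W))"

definition theta_PP ::
  "real \<Rightarrow> real \<Rightarrow> real \<Rightarrow> (real^'d) set \<Rightarrow> state \<Rightarrow> (real^'d \<Rightarrow> state) \<Rightarrow> real"
  where "theta_PP \<gamma> \<epsilon>\<^sub>\<rho> \<epsilon>\<^sub>p X W U =
    (GREATEST \<theta>. \<theta> \<in> {0..1} \<and> (\<forall>x\<in>X. scaled W U \<theta> x \<in> admissible_eps \<gamma> \<epsilon>\<^sub>\<rho> \<epsilon>\<^sub>p))"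

(* U is the positivity-scaled polynomial, b the entropy bound. *)
definition entropy_scaling ::
  "real \<Rightarrow> (real \<Rightarrow> real) \<Rightarrow> nat \<Rightarrow> (nat \<Rightarrow> real) \<Rightarrow> (nat \<Rightarrow> real^'d) \<Rightarrow> real
    \<Rightarrow> state \<Rightarrow> (real^'d \<Rightarrow> state) \<Rightarrow> real"
  where "entropy_scaling \<gamma> f N \<omega> node b W U =
    (let \<Phi> = (\<lambda>\<theta>. quad_entropy \<gamma> f N \<omega> node (scaled W U \<theta>))
     in if \<Phi> 1 \<le> b then 1 else (THE \<theta>. \<theta> \<in> {0..<1} \<and> \<Phi> \<theta> = b))"

definition theta_K ::
  "real \<Rightarrow> nat \<Rightarrow> (nat \<Rightarrow> real \<Rightarrow> real) \<Rightarrow> nat \<Rightarrow> (nat \<Rightarrow> real) \<Rightarrow> (nat \<Rightarrow> real^'d) \<Rightarrow> (nat \<Rightarrow> real)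
    \<Rightarrow> real \<Rightarrow> real \<Rightarrow> (real^'d) set \<Rightarrow> state \<Rightarrow> (real^'d \<Rightarrow> state) \<Rightarrow> real"
  where "theta_K \<gamma> M f N \<omega> node b \<epsilon>\<^sub>\<rho> \<epsilon>\<^sub>p X W U =
    (let \<theta> = theta_PP \<gamma> \<epsilon>\<^sub>\<rho> \<epsilon>\<^sub>p X W U
     in \<theta> * (MIN r\<in>{1..M}. entropy_scaling \<gamma> (f r) N \<omega> node (b r) W (scaled W U \<theta>)))"

end

theory Submission
  imports Defs
begin

text \<open>
  Each entropy has, at every admissible state, a supporting hyperplane that touches its graph only
  there. In the variables \<open>\<rho>\<close>, \<open>p\<close> this reduces to \<open>f s - f s\<^sub>0 \<le> \<gamma> * f' s\<^sub>0 * (exp ((s - s\<^sub>0) / \<gamma>) - 1)\<close>,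
  which holds because \<open>f' z * exp (- z / \<gamma>)\<close> is strictly decreasing, together with a Bernoulli inequality;
  the step to the conserved variables uses that the internal energy is concave and that the entropy
  decreases in \<open>p\<close>. Hence every \<open>\<Phi>\<^sub>r\<close> is convex on \<open>[0, 1]\<close> and, by the equality case of Jensen's
  inequality, either constant or strictly above \<open>\<Phi>\<^sub>r 0\<close> on \<open>(0, 1]\<close>. This makes the solution of
  \<open>\<Phi>\<^sub>r \<theta> = b\<^sub>r\<close> unique, and convexity gives the bound for all smaller \<open>\<theta>\<close>. The cell average and
  the magnetic constraint are preserved because they are affine in the polynomial.
\<close>

section \<open>Supporting hyperplanes\<close>

text \<open>Falling before \<open>a\<close> and rising after it, \<open>g\<close> has a strict
  global minimum at \<open>a\<close>. Both scalar inequalities behind the strict convexity of the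
  entropies take this form.\<close>

lemma less_if_deriv_sign_change:
  fixes g g' :: "real \<Rightarrow> real"
  assumes der: "\<And>z. (g has_real_derivative g' z) (at z)"
    and pos: "\<And>z. z > a \<Longrightarrow> g' z > 0" and neg: "\<And>z. z < a \<Longrightarrow> g' z < 0"
    and "z \<noteq> a"
  shows "g a < g z"
proof (cases "a < z")
  case True
  have "continuous_on {a..z} g"
    by (meson DERIV_isCont continuous_at_imp_continuous_on der)
  then show ?thesis
    using DERIV_pos_imp_increasing_open[OF True, of g] der pos by blast
next
  case False
  then have "z < a" using \<open>z \<noteq> a\<close> by simp
  moreover have "continuous_on {z..a} g"
    by (meson DERIV_isCont continuous_at_imp_continuous_on der)
  ultimately show ?thesis
    using DERIV_neg_imp_decreasing_open[of z a g] der neg by blast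
qed

text \<open>Evaluating the affine minorant that touches \<open>g\<close> at the combined point and
  averaging it over the two end points cancels its linear part.\<close>

lemma convex_on_if_supporting:
  fixes g :: "'a::real_vector \<Rightarrow> real"
  assumes "convex S"
    and supp: "\<And>z. z \<in> S \<Longrightarrow> \<exists>L. linear L \<and> (\<forall>v\<in>S. g z + L (v - z) \<le> g v)"
  shows "convex_on S g"
proof (rule convex_onI)
  fix t :: real and x y
  assume t: "0 < t" "t < 1" and xy: "x \<in> S" "y \<in> S"
  define z where "z = (1 - t) *\<^sub>R x + t *\<^sub>R y"
  have "z \<in> S"
    unfolding z_def using \<open>convex S\<close> t xy by (simp add: convex_alt)
  then obtain L where L: "linear L" "\<And>v. v \<in> S \<Longrightarrow> g z + L (v - z) \<le> g v"
    using supp by blast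
  have "(1 - t) * L (x - z) + t * L (y - z) = L ((1 - t) *\<^sub>R (x - z) + t *\<^sub>R (y - z))"
    by (simp add: linear_add[OF L(1)] linear_cmul[OF L(1)])
  also have "(1 - t) *\<^sub>R (x - z) + t *\<^sub>R (y - z) = 0"
    by (simp add: z_def algebra_simps)
  finally have "(1 - t) * L (x - z) + t * L (y - z) = 0"
    by (simp add: linear_0[OF L(1)])
  moreover have "(1 - t) * (g z + L (x - z)) + t * (g z + L (y - z)) \<le> (1 - t) * g x + t * g y"
    using t xy by (intro add_mono mult_left_mono L(2)) auto
  ultimately show "g ((1 - t) *\<^sub>R x + t *\<^sub>R y) \<le> (1 - t) * g x + t * g y"
    unfolding z_def[symmetric] by (simp add: algebra_simps)
qed (fact \<open>convex S\<close>)

text \<open>The weighted mean of the minorant at the points \<open>v i\<close> is exactly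
  \<open>g z\<close>, because \<open>z\<close> is their barycentre. The index \<open>j\<close>
  contributes a strict gap with positive weight. A minorant at the single point \<open>z\<close>
  suffices.\<close>

lemma strict_jensen_if_supporting:
  fixes g :: "'a::real_vector \<Rightarrow> real"
  assumes "finite I" and "\<And>i. i \<in> I \<Longrightarrow> \<omega> i > 0" and "sum \<omega> I = 1"
    and "(\<Sum>i\<in>I. \<omega> i *\<^sub>R v i) = z" and "\<And>i. i \<in> I \<Longrightarrow> v i \<in> S"
    and L: "linear L" "\<And>v. v \<in> S \<Longrightarrow> v \<noteq> z \<Longrightarrow> g z + L (v - z) < g v"
    and "j \<in> I" "v j \<noteq> z"
  shows "g z < (\<Sum>i\<in>I. \<omega> i * g (v i))"
proof -
  have "(\<Sum>i\<in>I. \<omega> i * L (v i - z)) = L (\<Sum>i\<in>I. \<omega> i *\<^sub>R (v i - z))"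
    by (simp add: linear_sum[OF L(1)] linear_cmul[OF L(1)])
  also have "(\<Sum>i\<in>I. \<omega> i *\<^sub>R (v i - z)) = 0"
    using assms(3,4) by (simp add: scaleR_diff_right sum_subtractf flip: scaleR_left.sum)
  finally have "(\<Sum>i\<in>I. \<omega> i * L (v i - z)) = 0"
    by (simp add: linear_0[OF L(1)])
  then have "g z = (\<Sum>i\<in>I. \<omega> i * (g z + L (v i - z)))"
    using assms(3) by (simp add: distrib_left sum.distrib flip: sum_distrib_right)
  also have "\<dots> < (\<Sum>i\<in>I. \<omega> i * g (v i))"
  proof (rule sum_strict_mono_ex1)
    show "\<forall>i\<in>I. \<omega> i * (g z + L (v i - z)) \<le> \<omega> i * g (v i)"
    proof
      fix i assume i: "i \<in> I"
      have "g z + L (v i - z) \<le> g (v i)"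
        using L assms(5)[OF i] by (cases "v i = z") (auto simp: linear_0 less_imp_le)
      then show "\<omega> i * (g z + L (v i - z)) \<le> \<omega> i * g (v i)"
        using assms(2)[OF i] by simp
    qed
    show "\<exists>i\<in>I. \<omega> i * (g z + L (v i - z)) < \<omega> i * g (v i)"
      using assms(2,5,8,9) L(2) by (intro bexI[of _ j]) auto
  qed fact
  finally show ?thesis .
qed

section \<open>Concavity of the internal energy\<close>

lemmas state_simps = mass_density_def momentum_def magnetic_field_def total_energy_def

lemma mass_density_linear: "linear mass_density"
  and momentum_linear: "linear momentum"
  and magnetic_field_linear: "linear magnetic_field"
  and total_energy_linear: "linear total_energy"
  by (auto intro!: linearI simp: state_simps)

text \<open>Internal energy can replace total energy as the last coordinate of a state. This is what
  identifies the equality case for the supporting hyperplane.\<close>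

lemma state_eqI:
  assumes "mass_density U = mass_density V" "momentum U = momentum V"
    "magnetic_field U = magnetic_field V" "internal_energy U = internal_energy V"
  shows "U = V"
  using assms by (auto simp: internal_energy_def state_simps intro!: prod_eqI)

text \<open>The derivative of \<open>internal_energy\<close> at \<open>Z\<close>, applied to the
  direction \<open>V\<close>.\<close>

definition internal_energy_deriv :: "state \<Rightarrow> state \<Rightarrow> real"
  where "internal_energy_deriv Z V =
    total_energy V - (momentum Z \<bullet> momentum V) / mass_density Z
      + (norm (momentum Z))\<^sup>2 / (2 * (mass_density Z)\<^sup>2) * mass_density V
      - magnetic_field Z \<bullet> magnetic_field V"

lemma internal_energy_deriv_linear: "linear (internal_energy_deriv Z)"
  by (rule linearI)
    (simp_all add: internal_energy_deriv_def linear_add[OF mass_density_linear]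
      linear_add[OF momentum_linear] linear_add[OF magnetic_field_linear]
      linear_add[OF total_energy_linear] linear_cmul[OF mass_density_linear]
      linear_cmul[OF momentum_linear] linear_cmul[OF magnetic_field_linear]
      linear_cmul[OF total_energy_linear] add_divide_distrib algebra_simps)

text \<open>Completing squares turns the second-order remainder into an exact expression. In terms
  of the velocities u = m / \<rho> the kinetic part is \<rho> |u - u_Z|^2 / 2, with \<rho> the
  density of \<open>V\<close>. Both squares enter with a minus sign, which is the source of
  concavity.\<close>

lemma internal_energy_expansion:
  assumes "mass_density Z > 0" "mass_density V > 0"
  shows "internal_energy V = internal_energy Z + internal_energy_deriv Z (V - Z)
    - (norm (momentum V - (mass_density V / mass_density Z) *\<^sub>R momentum Z))\<^sup>2 / (2 * mass_density V)
    - (norm (magnetic_field V - magnetic_field Z))\<^sup>2 / 2"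
proof -
  obtain r m B E where V: "V = (r, m, B, E)" by (metis prod.exhaust)
  obtain r\<^sub>0 m\<^sub>0 B\<^sub>0 E\<^sub>0 where Z: "Z = (r\<^sub>0, m\<^sub>0, B\<^sub>0, E\<^sub>0)" by (metis prod.exhaust)
  have r: "r > 0" "r\<^sub>0 > 0" using assms by (auto simp: V Z state_simps)
  have *: "(norm (m - (r / r\<^sub>0) *\<^sub>R m\<^sub>0))\<^sup>2 = m \<bullet> m - 2 * (r / r\<^sub>0) * (m\<^sub>0 \<bullet> m) + (r / r\<^sub>0)\<^sup>2 * (m\<^sub>0 \<bullet> m\<^sub>0)"
    unfolding power2_norm_eq_inner
    by (simp add: inner_diff_right inner_commute power2_eq_square algebra_simps)
  have **: "(norm (B - B\<^sub>0))\<^sup>2 = B \<bullet> B - 2 * (B\<^sub>0 \<bullet> B) + B\<^sub>0 \<bullet> B\<^sub>0"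
    unfolding power2_norm_eq_inner by (simp add: inner_diff_right inner_commute algebra_simps)
  show ?thesis
    unfolding internal_energy_def internal_energy_deriv_def V Z state_simps
      diff_Pair fst_conv snd_conv * ** inner_diff_right power2_norm_eq_inner
    using r by (simp add: field_simps) (simp add: power2_eq_square inner_commute algebra_simps)
qed

lemma internal_energy_le_tangent:
  assumes "mass_density Z > 0" "mass_density V > 0"
  shows "internal_energy V \<le> internal_energy Z + internal_energy_deriv Z (V - Z)"
  using internal_energy_expansion[OF assms] assms
  by (smt (verit) divide_nonneg_pos zero_le_power2)

text \<open>At equal densities the remainder vanishes only if momentum and field both agree. The
  densities are fixed because the internal energy is affine along states with a common velocity and
  field, so the tangent bound is not strict in general.\<close>

lemma internal_energy_less_tangent:
  assumes "mass_density Z > 0" "mass_density V = mass_density Z"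
    and "momentum V \<noteq> momentum Z \<or> magnetic_field V \<noteq> magnetic_field Z"
  shows "internal_energy V < internal_energy Z + internal_energy_deriv Z (V - Z)"
proof -
  have "(norm (momentum V - momentum Z))\<^sup>2 / (2 * mass_density Z) \<ge> 0"
    "(norm (magnetic_field V - magnetic_field Z))\<^sup>2 / 2 \<ge> 0"
    "(norm (momentum V - momentum Z))\<^sup>2 / (2 * mass_density Z) > 0 \<or>
     (norm (magnetic_field V - magnetic_field Z))\<^sup>2 / 2 > 0"
    using assms by auto
  then show ?thesis
    using internal_energy_expansion[of Z V] assms(1,2) by (simp, argo)
qed

lemma convex_positive_density: "convex {U. mass_density U > 0}"
proof -
  have "{U. mass_density U > 0} = mass_density -` {0<..}" by auto
  then show ?thesis
    by (simp add: convex_linear_vimage mass_density_linear)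
qed

lemma concave_internal_energy: "concave_on {U. mass_density U > 0} internal_energy"
  unfolding concave_on_def
proof (rule convex_on_if_supporting[OF convex_positive_density])
  fix Z assume "Z \<in> {U. mass_density U > 0}"
  then show "\<exists>L. linear L \<and> (\<forall>V\<in>{U. mass_density U > 0}.
      - internal_energy Z + L (V - Z) \<le> - internal_energy V)"
    using internal_energy_le_tangent[of Z] internal_energy_deriv_linear[of Z]
    by (intro exI[of _ "\<lambda>V. - internal_energy_deriv Z V"] conjI linear_compose_neg ballI)
      (force simp del: split_paired_All)+
qed

lemma internal_energy_segment:
  assumes "mass_density U > 0" "mass_density V > 0" "0 \<le> t" "t \<le> 1"
  shows "(1 - t) * internal_energy U + t * internal_energy V
    \<le> internal_energy ((1 - t) *\<^sub>R U + t *\<^sub>R V)"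
  using concave_onD[OF concave_internal_energy, of t U V] assms by simp

lemma convex_energy_level:
  "convex {U. mass_density U > 0 \<and> mass_density U \<ge> a \<and> internal_energy U \<ge> c}"
  unfolding convex_alt
proof (intro ballI allI impI)
  fix U V and t :: real
  assume UV: "U \<in> {U. mass_density U > 0 \<and> mass_density U \<ge> a \<and> internal_energy U \<ge> c}"
    "V \<in> {U. mass_density U > 0 \<and> mass_density U \<ge> a \<and> internal_energy U \<ge> c}"
    and t: "0 \<le> t \<and> t \<le> 1"
  have "mass_density ((1 - t) *\<^sub>R U + t *\<^sub>R V) = (1 - t) * mass_density U + t * mass_density V"
    by (simp add: state_simps)
  moreover have "(1 - t) * mass_density U + t * mass_density V \<ge> min (mass_density U) (mass_density V)"
    "(1 - t) * internal_energy U + t * internal_energy V \<ge> min (internal_energy U) (internal_energy V)"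
    using t convex_bound_le[of "- mass_density U" "- min (mass_density U) (mass_density V)"
        "- mass_density V" "1 - t" t]
      convex_bound_le[of "- internal_energy U" "- min (internal_energy U) (internal_energy V)"
        "- internal_energy V" "1 - t" t]
    by auto
  ultimately show "(1 - t) *\<^sub>R U + t *\<^sub>R V
      \<in> {U. mass_density U > 0 \<and> mass_density U \<ge> a \<and> internal_energy U \<ge> c}"
    using internal_energy_segment[of U V t] UV t by (auto simp: min_def split: if_splits)
qed

lemma convex_admissible: "convex admissible"
  unfolding convex_alt
proof (intro ballI allI impI)
  fix U V and t :: real
  assume UV: "U \<in> admissible" "V \<in> admissible" and t: "0 \<le> t \<and> t \<le> 1"
  \<comment> \<open>The level is the smaller of the two internal energies. It is positive, so a
    closed superlevel set delivers the strict inequality.\<close>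
  let ?S = "{U'. mass_density U' > 0 \<and> mass_density U' \<ge> 0
    \<and> internal_energy U' \<ge> min (internal_energy U) (internal_energy V)}"
  have "U \<in> ?S" "V \<in> ?S"
    using UV by (auto simp: admissible_def)
  then have "(1 - t) *\<^sub>R U + t *\<^sub>R V \<in> ?S"
    using convex_energy_level[of 0 "min (internal_energy U) (internal_energy V)"] t
    unfolding convex_alt by blast
  then show "(1 - t) *\<^sub>R U + t *\<^sub>R V \<in> admissible"
    using UV by (auto simp: admissible_def)
qed

lemma convex_admissible_eps:
  assumes "\<gamma> > 1"
  shows "convex (admissible_eps \<gamma> a c)"
proof -
  have "admissible_eps \<gamma> a c = admissible \<inter>
      {U. mass_density U > 0 \<and> mass_density U \<ge> a \<and> internal_energy U \<ge> c / (\<gamma> - 1)}"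
    using assms by (auto simp: admissible_eps_def admissible_def pressure_def field_simps)
  then show ?thesis
    by (simp add: convex_Int convex_admissible convex_energy_level)
qed

lemma continuous_on_internal_energy: "continuous_on {U. mass_density U > 0} internal_energy"
  unfolding internal_energy_def[abs_def] state_simps by (intro continuous_intros) auto

text \<open>The positive thresholds absorb the strict inequalities of \<open>admissible\<close>: the
  density stays away from 0, where the internal energy is singular, and positive pressure forces
  positive internal energy.\<close>

lemma closed_admissible_eps:
  assumes "\<gamma> > 1" "a > 0" "c > 0"
  shows "closed (admissible_eps \<gamma> a c)"
proof -
  have "closed {U. mass_density U \<ge> a}"
    unfolding state_simps by (intro closed_Collect_le continuous_intros)
  moreover have "continuous_on {U. mass_density U \<ge> a} internal_energy"
    using continuous_on_internal_energy by (rule continuous_on_subset) (use assms(2) in auto)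
  ultimately have "closed ({U. mass_density U \<ge> a} \<inter> internal_energy -` {c / (\<gamma> - 1)..})"
    by (intro continuous_closed_preimage) auto
  also have "{U. mass_density U \<ge> a} \<inter> internal_energy -` {c / (\<gamma> - 1)..} = admissible_eps \<gamma> a c"
  proof -
    \<comment> \<open>Here \<open>U\<close> is a real number standing for an internal
      energy.\<close>
    have "U > 0" if "c \<le> (\<gamma> - 1) * U" for U
      using assms(1,3) that by (smt (verit) mult_nonneg_nonpos)
    then show ?thesis
      using assms(1,2) by (fastforce simp: admissible_eps_def admissible_def pressure_def
          pos_divide_le_eq[of "\<gamma> - 1"] mult.commute[of _ "\<gamma> - 1"] )
  qed
  finally show ?thesis .
qed

section \<open>Strict convexity of the entropies\<close>

text \<open>Bernoulli's inequality 1 + \<gamma> (x - 1) < x^\<gamma> at x = exp y.\<close>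

lemma exp_bernoulli_strict:
  fixes \<gamma> y :: real
  assumes "\<gamma> > 1" "y \<noteq> 0"
  shows "\<gamma> * exp y < exp (\<gamma> * y) + \<gamma> - 1"
proof -
  have "exp (\<gamma> * 0) - \<gamma> * exp 0 < exp (\<gamma> * y) - \<gamma> * exp y"
  proof (rule less_if_deriv_sign_change[where a = 0 and g = "\<lambda>y. exp (\<gamma> * y) - \<gamma> * exp y"
        and g' = "\<lambda>y. \<gamma> * (exp (\<gamma> * y) - exp y)"])
    show "((\<lambda>y. exp (\<gamma> * y) - \<gamma> * exp y) has_real_derivative \<gamma> * (exp (\<gamma> * z) - exp z)) (at z)" for z
      by (auto intro!: derivative_eq_intros simp: algebra_simps)
    show "\<gamma> * (exp (\<gamma> * z) - exp z) > 0" if "z > 0" for z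
      using assms that by simp
    show "\<gamma> * (exp (\<gamma> * z) - exp z) < 0" if "z < 0" for z
      using assms that by (auto intro!: mult_pos_neg)
  qed fact
  then show ?thesis by simp
qed

lemma C2_DERIV:
  assumes "C2 f"
  shows "(f has_real_derivative deriv f z) (at z)"
    and "(deriv f has_real_derivative deriv (deriv f) z) (at z)"
  using assms by (auto simp: C2_def DERIV_deriv_iff_real_differentiable)

text \<open>The tangent inequality for \<open>f\<close> regarded as a function of w = exp (s /
  \<gamma>). Its derivative in w is \<open>\<gamma> * k\<close>, and the hypothesis on
  \<open>f\<close> says exactly that \<open>k\<close> is strictly decreasing, so this function is
  strictly concave.\<close>

lemma less_exp_bound:
  assumes "C2 f" "\<gamma> > 1" and "\<And>z. deriv f z - \<gamma> * deriv (deriv f) z > 0" and "s \<noteq> s\<^sub>0"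
  shows "f s - f s\<^sub>0 < \<gamma> * deriv f s\<^sub>0 * (exp ((s - s\<^sub>0) / \<gamma>) - 1)"
proof -
  note [derivative_intros] = C2_DERIV[OF assms(1), THEN DERIV_chain2]
  define k where "k = (\<lambda>z. deriv f z * exp (- z / \<gamma>))"
  have "(k has_real_derivative
      - exp (- z / \<gamma>) / \<gamma> * (deriv f z - \<gamma> * deriv (deriv f) z)) (at z)" for z
    unfolding k_def using \<open>\<gamma> > 1\<close> by (auto intro!: derivative_eq_intros simp: field_simps)
  moreover have "- exp (- z / \<gamma>) / \<gamma> * (deriv f z - \<gamma> * deriv (deriv f) z) < 0" for z
    using assms(2) assms(3)[of z] by (intro mult_neg_pos) auto
  ultimately have k: "k v < k u" if "u < v" for u v
    using that by (intro DERIV_neg_imp_decreasing[of u v k]) blast+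
  have k': "deriv f s\<^sub>0 * exp ((z - s\<^sub>0) / \<gamma>) = k s\<^sub>0 * exp (z / \<gamma>)"
    "deriv f z = k z * exp (z / \<gamma>)" for z
    by (simp_all add: k_def diff_divide_distrib exp_diff exp_minus field_simps)
  define g where "g = (\<lambda>z. \<gamma> * deriv f s\<^sub>0 * exp ((z - s\<^sub>0) / \<gamma>) - f z)"
  have "g s\<^sub>0 < g s"
  proof (rule less_if_deriv_sign_change[where g = g and a = "s\<^sub>0"
        and g' = "\<lambda>z. (k s\<^sub>0 - k z) * exp (z / \<gamma>)"])
    show "(g has_real_derivative (k s\<^sub>0 - k z) * exp (z / \<gamma>)) (at z)" for z
      unfolding g_def left_diff_distrib k'[symmetric]
      using \<open>\<gamma> > 1\<close> by (auto intro!: derivative_eq_intros)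
    show "(k s\<^sub>0 - k z) * exp (z / \<gamma>) > 0" if "z > s\<^sub>0" for z
      using k[OF that] by simp
    show "(k s\<^sub>0 - k z) * exp (z / \<gamma>) < 0" if "z < s\<^sub>0" for z
      using k[OF that] by (simp add: mult_neg_pos)
  qed fact
  then show ?thesis by (simp add: g_def algebra_simps)
qed

text \<open>The left side is the first-order Taylor polynomial of the entropy in the variables
  \<rho> and p. After division by \<rho> the claim follows by chaining the exponential bound on
  \<open>f\<close> with Bernoulli's inequality.\<close>

lemma entropy_tangent_density_pressure:
  fixes \<gamma> \<rho> p \<rho>\<^sub>0 p\<^sub>0 :: real
  defines "s \<equiv> ln p - \<gamma> * ln \<rho>" and "s\<^sub>0 \<equiv> ln p\<^sub>0 - \<gamma> * ln \<rho>\<^sub>0"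
  assumes f: "C2 f" and \<gamma>: "\<gamma> > 1"
    and f': "\<And>z. deriv f z > 0" and f'': "\<And>z. deriv f z - \<gamma> * deriv (deriv f) z > 0"
    and pos: "\<rho> > 0" "p > 0" "\<rho>\<^sub>0 > 0" "p\<^sub>0 > 0" and neq: "\<rho> \<noteq> \<rho>\<^sub>0 \<or> p \<noteq> p\<^sub>0"
  shows "- \<rho>\<^sub>0 * f s\<^sub>0 + (\<gamma> * deriv f s\<^sub>0 - f s\<^sub>0) * (\<rho> - \<rho>\<^sub>0) - \<rho>\<^sub>0 * deriv f s\<^sub>0 / p\<^sub>0 * (p - p\<^sub>0)
    < - \<rho> * f s"
proof -
  define x where "x = ln \<rho> - ln \<rho>\<^sub>0"
  \<comment> \<open>With this choice \<open>\<gamma> * y\<close> is the logarithm of the pressure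
    ratio, and \<open>exp ((s - s\<^sub>0) / \<gamma>)\<close> factors as
    \<open>exp (- x) * exp y\<close>.\<close>
  define y where "y = (s - s\<^sub>0) / \<gamma> + x"
  define c where "c = deriv f s\<^sub>0"
  have c: "c > 0" by (simp add: c_def f')
  have \<rho>: "\<rho>\<^sub>0 / \<rho> = exp (- x)"
    using pos by (simp add: x_def exp_diff)
  have \<gamma>y: "\<gamma> * y = ln p - ln p\<^sub>0"
    using \<gamma> by (simp add: y_def x_def s_def s\<^sub>0_def field_simps)
  have p: "p / p\<^sub>0 = exp (\<gamma> * y)"
    using pos by (simp add: \<gamma>y exp_diff)
  have exp_y: "exp ((s - s\<^sub>0) / \<gamma>) = exp (- x) * exp y"
    by (simp add: y_def flip: exp_add)
  have "f s - f s\<^sub>0 < c * (exp (- x) * (exp (\<gamma> * y) + \<gamma> - 1) - \<gamma>)"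
  \<comment> \<open>Bernoulli is strict unless \<open>y = 0\<close>, the exponential bound unless
    \<open>s = s\<^sub>0\<close>. Both equalities together would make densities and pressures
    agree.\<close>
  proof (cases "y = 0")
    case True
    have "s \<noteq> s\<^sub>0"
    proof
      assume "s = s\<^sub>0"
      with True have "x = 0" by (simp add: y_def)
      with True \<rho> p neq pos show False by auto
    qed
    then have "f s - f s\<^sub>0 < \<gamma> * c * (exp ((s - s\<^sub>0) / \<gamma>) - 1)"
      unfolding c_def by (rule less_exp_bound[OF f \<gamma> f''])
    then show ?thesis
      unfolding exp_y using True by (simp add: algebra_simps)
  next
    case False
    have "f s - f s\<^sub>0 \<le> \<gamma> * c * (exp ((s - s\<^sub>0) / \<gamma>) - 1)"
      using less_exp_bound[OF f \<gamma> f'', of s s\<^sub>0] by (cases "s = s\<^sub>0") (auto simp: c_def)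
    also have "\<dots> = c * (exp (- x) * (\<gamma> * exp y) - \<gamma>)"
      unfolding exp_y by (simp add: algebra_simps)
    also have "\<dots> < c * (exp (- x) * (exp (\<gamma> * y) + \<gamma> - 1) - \<gamma>)"
      using exp_bernoulli_strict[OF \<gamma> False] c by simp
    finally show ?thesis .
  qed
  then have "\<rho> * (f s - f s\<^sub>0) < \<rho> * (c * (\<rho>\<^sub>0 / \<rho> * (p / p\<^sub>0 + \<gamma> - 1) - \<gamma>))"
    using pos by (simp add: \<rho> p)
  also have "\<dots> = c * (\<rho>\<^sub>0 * (p / p\<^sub>0 + \<gamma> - 1) - \<gamma> * \<rho>)"
    using pos by (simp add: field_simps)
  finally have "\<rho> * (f s - f s\<^sub>0) < c * (\<rho>\<^sub>0 * (p / p\<^sub>0 + \<gamma> - 1) - \<gamma> * \<rho>)" .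
  moreover have "\<rho>\<^sub>0 * c / p\<^sub>0 * (p - p\<^sub>0) = \<rho>\<^sub>0 * c * (p / p\<^sub>0 - 1)"
    using pos by (simp add: field_simps)
  ultimately show ?thesis
    unfolding c_def[symmetric] by (simp add: algebra_simps)
qed

text \<open>By the chain rule \<open>L\<close> is the tangent map in \<rho> and p with the pressure
  linearised in the conserved variables. Pressure is concave and has the negative coefficient
  \<open>- \<beta>\<close>, so linearising it only lowers the plane.\<close>

lemma entropy_supporting_hyperplane:
  assumes "C2 f" and \<gamma>: "\<gamma> > 1"
    and f': "\<And>z. deriv f z > 0" and "\<And>z. deriv f z - \<gamma> * deriv (deriv f) z > 0"
    and Z: "Z \<in> admissible"
  obtains L where "linear L"
    and "\<And>V. V \<in> admissible \<Longrightarrow> V \<noteq> Z \<Longrightarrow> entropy \<gamma> f Z + L (V - Z) < entropy \<gamma> f V"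
proof -
  define s where "s = specific_entropy \<gamma> Z"
  define \<alpha> \<beta> where "\<alpha> = \<gamma> * deriv f s - f s" and "\<beta> = mass_density Z * deriv f s / pressure \<gamma> Z"
  define L where "L = (\<lambda>V. \<alpha> * mass_density V - \<beta> * ((\<gamma> - 1) * internal_energy_deriv Z V))"
  have pos: "mass_density V > 0 \<and> pressure \<gamma> V > 0" if "V \<in> admissible" for V
    using that \<gamma> by (simp add: admissible_def pressure_def)
  have \<beta>: "\<beta> > 0"
    using pos[OF Z] f' by (simp add: \<beta>_def)
  have "linear L"
    by (rule linearI)
      (simp_all add: L_def linear_add[OF mass_density_linear] linear_cmul[OF mass_density_linear]
        linear_add[OF internal_energy_deriv_linear] linear_cmul[OF internal_energy_deriv_linear]
        algebra_simps)
  moreover have "entropy \<gamma> f Z + L (V - Z) < entropy \<gamma> f V" if V: "V \<in> admissible" "V \<noteq> Z" for V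
  proof -
    have "\<beta> * (\<gamma> - 1) > 0" using \<beta> \<gamma> by simp
    have L: "L (V - Z) = \<alpha> * (mass_density V - mass_density Z) - \<beta> * (pressure \<gamma> V - pressure \<gamma> Z)
        - \<beta> * (\<gamma> - 1) * (internal_energy Z + internal_energy_deriv Z (V - Z) - internal_energy V)"
      by (simp add: L_def pressure_def linear_diff[OF mass_density_linear] algebra_simps)
    show ?thesis
    \<comment> \<open>If density and pressure agree, strictness comes from a difference in momentum
      or field; otherwise it comes from the inequality in \<rho> and p.\<close>
    proof (cases "mass_density V = mass_density Z \<and> pressure \<gamma> V = pressure \<gamma> Z")
      case True
      then have "internal_energy V = internal_energy Z"
        using \<gamma> by (simp add: pressure_def)
      then have "internal_energy V < internal_energy Z + internal_energy_deriv Z (V - Z)"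
        using True V(2) pos[OF Z] state_eqI[of V Z] by (intro internal_energy_less_tangent) auto
      then have "L (V - Z) < 0"
        using True \<open>\<beta> * (\<gamma> - 1) > 0\<close> by (simp add: L)
      then show ?thesis
        using True by (simp add: entropy_def specific_entropy_def)
    next
      case False
      have "internal_energy V \<le> internal_energy Z + internal_energy_deriv Z (V - Z)"
        using pos V(1) Z by (intro internal_energy_le_tangent) auto
      then have "L (V - Z) \<le> \<alpha> * (mass_density V - mass_density Z) - \<beta> * (pressure \<gamma> V - pressure \<gamma> Z)"
        using \<open>\<beta> * (\<gamma> - 1) > 0\<close> by (simp add: L)
      moreover have "- mass_density Z * f s + \<alpha> * (mass_density V - mass_density Z)
          - \<beta> * (pressure \<gamma> V - pressure \<gamma> Z) < entropy \<gamma> f V"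
        using entropy_tangent_density_pressure[OF assms(1-4), of "mass_density V" "pressure \<gamma> V"
            "mass_density Z" "pressure \<gamma> Z"] pos[OF V(1)] pos[OF Z] False
        by (simp add: \<alpha>_def \<beta>_def s_def entropy_def specific_entropy_def)
      ultimately show ?thesis
        by (simp add: entropy_def s_def)
    qed
  qed
  ultimately show thesis by (rule that)
qed

lemma convex_on_entropy:
  assumes "C2 f" and "\<gamma> > 1"
    and "\<And>z. deriv f z > 0" and "\<And>z. deriv f z - \<gamma> * deriv (deriv f) z > 0"
  shows "convex_on admissible (entropy \<gamma> f)"
proof (rule convex_on_if_supporting[OF convex_admissible])
  fix Z assume "Z \<in> admissible"
  then obtain L where L: "linear L"
    "\<And>V. V \<in> admissible \<Longrightarrow> V \<noteq> Z \<Longrightarrow> entropy \<gamma> f Z + L (V - Z) < entropy \<gamma> f V"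
    using entropy_supporting_hyperplane[OF assms] by blast
  have "entropy \<gamma> f Z + L (V - Z) \<le> entropy \<gamma> f V" if "V \<in> admissible" for V
    using L that by (cases "V = Z") (auto simp: linear_0 less_imp_le)
  then show "\<exists>L. linear L \<and> (\<forall>V\<in>admissible. entropy \<gamma> f Z + L (V - Z) \<le> entropy \<gamma> f V)"
    using L(1) by blast
qed

lemma continuous_on_entropy:
  assumes "C2 f" "\<gamma> > 1"
  shows "continuous_on admissible (entropy \<gamma> f)"
proof -
  have "continuous_on UNIV f"
    using C2_DERIV(1)[OF assms(1)] by (meson DERIV_isCont continuous_at_imp_continuous_on)
  moreover have \<rho>: "continuous_on admissible mass_density"
    unfolding mass_density_def[abs_def] by (intro continuous_intros)
  moreover have "continuous_on admissible internal_energy"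
    using continuous_on_internal_energy by (rule continuous_on_subset) (auto simp: admissible_def)
  then have "continuous_on admissible (specific_entropy \<gamma>)"
    unfolding specific_entropy_def[abs_def] pressure_def[abs_def]
    using \<rho> assms(2) by (intro continuous_intros) (auto simp: admissible_def)
  ultimately show ?thesis
    unfolding entropy_def[abs_def]
    by (intro continuous_intros) (auto intro: continuous_on_compose2)
qed

section \<open>The scaling parameters\<close>

lemma scaled_convex_combination: "scaled W U \<theta> x = (1 - \<theta>) *\<^sub>R W + \<theta> *\<^sub>R U x"
  by (simp add: scaled_def algebra_simps)

lemma scaled_scaled: "scaled W (scaled W U \<theta>) \<theta>' = scaled W U (\<theta> * \<theta>')"
  by (simp add: scaled_def fun_eq_iff mult.commute)

lemma scaled_average:
  assumes "sum \<omega> I = 1" "(\<Sum>i\<in>I. \<omega> i *\<^sub>R U (node i)) = W"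
  shows "(\<Sum>i\<in>I. \<omega> i *\<^sub>R scaled W U \<theta> (node i)) = W"
proof -
  have "(\<Sum>i\<in>I. \<omega> i *\<^sub>R scaled W U \<theta> (node i))
      = (1 - \<theta>) *\<^sub>R (sum \<omega> I *\<^sub>R W) + \<theta> *\<^sub>R (\<Sum>i\<in>I. \<omega> i *\<^sub>R U (node i))"
    by (simp add: scaled_convex_combination scaleR_add_right sum.distrib scaleR_sum_right
        scaleR_left.sum mult.commute)
  then show ?thesis
    using assms by (simp add: algebra_simps)
qed

lemma scaled_mem_convex:
  assumes "convex S" "W \<in> S" "U x \<in> S" "0 \<le> \<theta>" "\<theta> \<le> 1"
  shows "scaled W U \<theta> x \<in> S"
  using assms by (simp add: scaled_convex_combination convex_alt)

text \<open>The greatest element is attained: the feasible scalars form a compact set, which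
  contains 0 because \<open>W\<close> itself meets the thresholds.\<close>

lemma theta_PP_properties:
  fixes U :: "real^'d \<Rightarrow> state" and X :: "(real^'d) set"
  assumes "\<gamma> > 1" "\<epsilon>\<^sub>\<rho> > 0" "\<epsilon>\<^sub>p > 0" and W: "W \<in> admissible_eps \<gamma> \<epsilon>\<^sub>\<rho> \<epsilon>\<^sub>p"
  defines "\<theta> \<equiv> theta_PP \<gamma> \<epsilon>\<^sub>\<rho> \<epsilon>\<^sub>p X W U"
  shows "\<theta> \<in> {0..1}" and "\<forall>x\<in>X. scaled W U \<theta> x \<in> admissible_eps \<gamma> \<epsilon>\<^sub>\<rho> \<epsilon>\<^sub>p"
proof -
  let ?G = "admissible_eps \<gamma> \<epsilon>\<^sub>\<rho> \<epsilon>\<^sub>p"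
  define T where "T = {\<theta>. \<theta> \<in> {0..1} \<and> (\<forall>x\<in>X. scaled W U \<theta> x \<in> ?G)}"
  have "closed ((\<lambda>\<theta>. scaled W U \<theta> x) -` ?G)" for x
    unfolding scaled_def using closed_admissible_eps[OF assms(1-3)]
    by (rule closed_vimage) (intro continuous_intros)
  then have "closed ({0..1} \<inter> (\<Inter>x\<in>X. (\<lambda>\<theta>. scaled W U \<theta> x) -` ?G))"
    by (intro closed_Int closed_INT) auto
  moreover have "T = {0..1} \<inter> (\<Inter>x\<in>X. (\<lambda>\<theta>. scaled W U \<theta> x) -` ?G)"
    by (auto simp: T_def)
  ultimately have "compact T"
    by (metis bounded_closed_interval bounded_Int compact_eq_bounded_closed)
  moreover have "0 \<in> T"
    using W by (simp add: T_def scaled_def)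
  ultimately obtain t where t: "t \<in> T" "\<And>u. u \<in> T \<Longrightarrow> u \<le> t"
    using compact_attains_sup[of T] by blast
  have "\<theta> = t"
    unfolding \<theta>_def theta_PP_def using t by (intro Greatest_equality) (auto simp: T_def)
  with t(1) show "\<theta> \<in> {0..1}" "\<forall>x\<in>X. scaled W U \<theta> x \<in> ?G"
    by (auto simp: T_def)
qed

lemma convex_unique_crossing:
  fixes \<Phi> :: "real \<Rightarrow> real"
  assumes conv: "convex_on {0..1} \<Phi>" and cont: "continuous_on {0..1} \<Phi>"
    and b: "\<Phi> 0 \<le> b" "b < \<Phi> 1"
    and min: "\<And>\<theta>. 0 < \<theta> \<Longrightarrow> \<theta> \<le> 1 \<Longrightarrow> \<Phi> 0 < \<Phi> \<theta>"
  shows "\<exists>!\<theta>. \<theta> \<in> {0..<1} \<and> \<Phi> \<theta> = b"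
proof -
  obtain t where t: "0 \<le> t" "t \<le> 1" "\<Phi> t = b"
    using IVT'[of \<Phi> 0 b 1] b cont by auto
  have False if uv: "0 \<le> u" "u < v" "v < 1" "\<Phi> u = b" "\<Phi> v = b" for u v
  proof -
    \<comment> \<open>A second solution \<open>v > 0\<close> excludes \<open>b = \<Phi> 0\<close>.
      Now \<open>u\<close> lies strictly between 0 and \<open>v\<close>, so convexity puts
      \<open>\<Phi> u\<close> strictly below \<open>b\<close>.\<close>
    have "\<Phi> 0 < b" using min[of v] uv by simp
    with uv have "u > 0" by (cases "u = 0") auto
    have "\<Phi> ((1 - u / v) *\<^sub>R 0 + (u / v) *\<^sub>R v) \<le> (1 - u / v) * \<Phi> 0 + u / v * \<Phi> v"
      using uv by (intro convex_onD[OF conv]) auto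
    then have "b \<le> (1 - u / v) * \<Phi> 0 + u / v * b"
      using uv by simp
    also have "\<dots> < (1 - u / v) * b + u / v * b"
      using uv \<open>\<Phi> 0 < b\<close> by simp
    finally show False by (simp add: algebra_simps)
  qed
  then have "u = v" if "u \<in> {0..<1}" "v \<in> {0..<1}" "\<Phi> u = b" "\<Phi> v = b" for u v
    using that by (metis atLeastLessThan_iff linorder_neqE_linordered_idom)
  moreover have "t \<in> {0..<1}"
    using t b by (cases "t = 1") auto
  ultimately show ?thesis
    using t(3) by blast
qed

text \<open>A convex function on \<open>{0..\<theta>}\<close> is bounded by its larger end value,
  and both end values are at most \<open>b\<close>. Stating the bound for every \<open>t\<close> up
  to \<open>\<theta>\<close> prepares the claim about smaller scalars.\<close>

lemma entropy_scaling_properties: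
  fixes node :: "nat \<Rightarrow> real^'d" and U :: "real^'d \<Rightarrow> state"
  assumes f: "C2 f" and \<gamma>: "\<gamma> > 1"
    and f': "\<And>z. deriv f z > 0" and f'': "\<And>z. deriv f z - \<gamma> * deriv (deriv f) z > 0"
    and \<omega>: "\<forall>a\<in>{1..N}. \<omega> a > 0" "(\<Sum>a=1..N. \<omega> a) = 1"
    and avg: "(\<Sum>a=1..N. \<omega> a *\<^sub>R U (node a)) = W"
    and adm: "\<forall>a\<in>{1..N}. U (node a) \<in> admissible" "W \<in> admissible"
    and b: "entropy \<gamma> f W \<le> b"
  defines "\<theta> \<equiv> entropy_scaling \<gamma> f N \<omega> node b W U"
  shows "\<theta> \<in> {0..1}" and "\<And>t. t \<in> {0..\<theta>} \<Longrightarrow> quad_entropy \<gamma> f N \<omega> node (scaled W U t) \<le> b"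
proof -
  define \<Phi> where "\<Phi> = (\<lambda>\<theta>. quad_entropy \<gamma> f N \<omega> node (scaled W U \<theta>))"
  have mem: "scaled W U t (node a) \<in> admissible" if "t \<in> {0..1}" "a \<in> {1..N}" for t a
    using that adm by (intro scaled_mem_convex convex_admissible) auto
  have \<Phi>0: "\<Phi> 0 = entropy \<gamma> f W"
    using \<omega>(2) by (simp add: \<Phi>_def quad_entropy_def scaled_def flip: sum_distrib_right)
  have conv: "convex_on {0..1} \<Phi>"
  proof (rule convex_onI)
    fix t u v :: real
    assume t: "0 < t" "t < 1" and uv: "u \<in> {0..1}" "v \<in> {0..1}"
    have "entropy \<gamma> f (scaled W U ((1 - t) *\<^sub>R u + t *\<^sub>R v) (node a))
        \<le> (1 - t) * entropy \<gamma> f (scaled W U u (node a)) + t * entropy \<gamma> f (scaled W U v (node a))"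
      if "a \<in> {1..N}" for a
    proof -
      have "scaled W U ((1 - t) *\<^sub>R u + t *\<^sub>R v) (node a)
          = (1 - t) *\<^sub>R scaled W U u (node a) + t *\<^sub>R scaled W U v (node a)"
        by (simp add: scaled_def algebra_simps)
      then show ?thesis
        using convex_onD[OF convex_on_entropy[OF f \<gamma> f' f''], of t] mem that t uv by simp
    qed
    then have "\<Phi> ((1 - t) *\<^sub>R u + t *\<^sub>R v) \<le> (\<Sum>a=1..N. \<omega> a *
        ((1 - t) * entropy \<gamma> f (scaled W U u (node a)) + t * entropy \<gamma> f (scaled W U v (node a))))"
      unfolding \<Phi>_def quad_entropy_def using \<omega>(1) by (intro sum_mono mult_left_mono) (auto intro: less_imp_le)
    also have "\<dots> = (1 - t) * \<Phi> u + t * \<Phi> v"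
      by (simp add: \<Phi>_def quad_entropy_def sum_distrib_left sum.distrib distrib_left mult.left_commute)
    finally show "\<Phi> ((1 - t) *\<^sub>R u + t *\<^sub>R v) \<le> (1 - t) * \<Phi> u + t * \<Phi> v" .
  qed simp
  have cont: "continuous_on {0..1} \<Phi>"
    unfolding \<Phi>_def quad_entropy_def
  proof (intro continuous_on_sum continuous_on_mult_left)
    fix a assume a: "a \<in> {1..N}"
    have "continuous_on {0..1} (\<lambda>t. scaled W U t (node a))"
      unfolding scaled_def by (intro continuous_intros)
    then show "continuous_on {0..1} (\<lambda>t. entropy \<gamma> f (scaled W U t (node a)))"
      using mem a by (intro continuous_on_compose2[OF continuous_on_entropy[OF f \<gamma>]]) auto
  qed
  \<comment> \<open>If all nodal values equal \<open>W\<close>, then \<open>\<Phi>\<close> is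
    constant; the first premise excludes this. It holds whenever the crossing is sought, since then
    \<open>\<Phi> 0 \<le> b < \<Phi> 1\<close>.\<close>
  have min: "\<Phi> 0 < \<Phi> t" if "\<Phi> 0 \<noteq> \<Phi> 1" "0 < t" "t \<le> 1" for t
  proof -
    have "\<exists>a\<in>{1..N}. U (node a) \<noteq> W"
    proof (rule ccontr)
      assume "\<not> (\<exists>a\<in>{1..N}. U (node a) \<noteq> W)"
      then have "\<Phi> 1 = \<Phi> 0"
        unfolding \<Phi>_def quad_entropy_def by (intro sum.cong) (auto simp: scaled_def)
      with \<open>\<Phi> 0 \<noteq> \<Phi> 1\<close> show False by simp
    qed
    then obtain j where j: "j \<in> {1..N}" "scaled W U t (node j) \<noteq> W"
      using \<open>0 < t\<close> by (auto simp: scaled_def)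
    have "(\<Sum>a=1..N. \<omega> a *\<^sub>R scaled W U t (node a)) = W"
      using \<omega>(2) avg by (rule scaled_average)
    moreover obtain L where "linear L"
      "\<And>V. V \<in> admissible \<Longrightarrow> V \<noteq> W \<Longrightarrow> entropy \<gamma> f W + L (V - W) < entropy \<gamma> f V"
      using entropy_supporting_hyperplane[OF f \<gamma> f' f'' adm(2)] by blast
    ultimately show ?thesis
      unfolding \<Phi>0 unfolding \<Phi>_def quad_entropy_def using \<omega> mem that j
      by (intro strict_jensen_if_supporting[where S = admissible and L = L and j = j]) auto
  qed
  have \<theta>: "\<theta> \<in> {0..1} \<and> \<Phi> \<theta> \<le> b"
  proof (cases "\<Phi> 1 \<le> b")
    case True
    then have "\<theta> = 1"
      by (simp add: \<theta>_def entropy_scaling_def \<Phi>_def Let_def)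
    then show ?thesis using True by simp
  next
    case False
    then have "\<theta> = (THE \<theta>. \<theta> \<in> {0..<1} \<and> \<Phi> \<theta> = b)"
      by (simp add: \<theta>_def entropy_scaling_def \<Phi>_def Let_def)
    moreover have "\<exists>!\<theta>. \<theta> \<in> {0..<1} \<and> \<Phi> \<theta> = b"
      using False b \<Phi>0 min by (intro convex_unique_crossing conv cont) auto
    ultimately have "\<theta> \<in> {0..<1} \<and> \<Phi> \<theta> = b"
      by (metis (mono_tags, lifting) theI')
    then show ?thesis by auto
  qed
  then show "\<theta> \<in> {0..1}" by blast
  show "quad_entropy \<gamma> f N \<omega> node (scaled W U t) \<le> b" if "t \<in> {0..\<theta>}" for t
  proof -
    have "convex_on {0..\<theta>} \<Phi>"
      using conv by (rule convex_on_subset) (use \<theta> in auto)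
    then have "\<Phi> t \<le> max (\<Phi> 0) (\<Phi> \<theta>)"
      using that by (intro convex_on_le_max)
    also have "\<dots> \<le> b"
      using \<theta> b \<Phi>0 by simp
    finally show ?thesis
      by (simp add: \<Phi>_def)
  qed
qed

section \<open>Polynomial states\<close>

text \<open>Finiteness gives the sums in \<open>poly_space\<close> their intended meaning: a sum
  over an infinite set is 0 by convention.\<close>

lemma finite_multi_indices: "finite {\<alpha> :: 'd::finite \<Rightarrow> nat. (\<Sum>i\<in>UNIV. \<alpha> i) \<le> k}"
proof (rule finite_subset)
  show "{\<alpha> :: 'd \<Rightarrow> nat. (\<Sum>i\<in>UNIV. \<alpha> i) \<le> k} \<subseteq> UNIV \<rightarrow>\<^sub>E {..k}"
    by (auto simp: PiE_def) (metis finite_class.finite_UNIV UNIV_I member_le_sum order_trans zero_le)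
qed (simp add: finite_PiE)

lemma const_in_poly_space: "(\<lambda>x::real^'d. w) \<in> poly_space k"
proof -
  have "(\<Sum>\<alpha> | (\<Sum>i\<in>UNIV. \<alpha> i) \<le> k. (if \<alpha> = (\<lambda>_. 0) then w else 0) * (\<Prod>i\<in>UNIV. (x $ i) ^ \<alpha> i)) = w"
    for x :: "real^'d"
    by (subst sum.remove[OF finite_multi_indices, of "\<lambda>_. 0"]) (auto intro!: sum.neutral)
  then show ?thesis
    unfolding poly_space_def by (intro CollectI exI[of _ "\<lambda>\<alpha>. if \<alpha> = (\<lambda>_. 0) then w else 0"]) simp
qed

lemma linear_combination_in_poly_space:
  assumes "p \<in> poly_space k" "q \<in> poly_space k"
  shows "(\<lambda>x. s * p x + t * q x) \<in> poly_space k"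
proof -
  obtain c d where
    "\<And>x. p x = (\<Sum>\<alpha> | (\<Sum>i\<in>UNIV. \<alpha> i) \<le> k. c \<alpha> * (\<Prod>i\<in>UNIV. (x $ i) ^ \<alpha> i))"
    "\<And>x. q x = (\<Sum>\<alpha> | (\<Sum>i\<in>UNIV. \<alpha> i) \<le> k. d \<alpha> * (\<Prod>i\<in>UNIV. (x $ i) ^ \<alpha> i))"
    using assms unfolding poly_space_def by blast
  then show ?thesis
    unfolding poly_space_def
    by (intro CollectI exI[of _ "\<lambda>\<alpha>. s * c \<alpha> + t * d \<alpha>"])
      (simp add: sum_distrib_left sum.distrib distrib_right mult.assoc)
qed

text \<open>Ensures that \<open>frechet_derivative\<close> in the magnetic constraint is a genuine
  derivative.\<close>

lemma poly_space_differentiable: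
  assumes "q \<in> poly_space k"
  shows "q differentiable (at x)"
proof -
  obtain c where q: "q = (\<lambda>x. \<Sum>\<alpha> | (\<Sum>i\<in>UNIV. \<alpha> i) \<le> k. c \<alpha> * (\<Prod>i\<in>UNIV. (x $ i) ^ \<alpha> i))"
    using assms unfolding poly_space_def by blast
  have "(\<lambda>x. \<Prod>i\<in>UNIV. (x $ i) ^ \<alpha> i) differentiable (at x)" for \<alpha> :: "'a \<Rightarrow> nat"
  proof -
    have *: "((\<lambda>x. (x $ i) ^ \<alpha> i) has_derivative (\<lambda>h. \<alpha> i * (h $ i) * (x $ i) ^ (\<alpha> i - 1))) (at x)" for i
      by (rule derivative_eq_intros bounded_linear.has_derivative[OF bounded_linear_vec_nth] refl)+
    show ?thesis
      unfolding differentiable_def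
      using has_derivative_prod[where I = UNIV and f = "\<lambda>i x. (x $ i) ^ \<alpha> i", OF *] by blast
  qed
  then show ?thesis
    unfolding q by (intro differentiable_sum differentiable_mult differentiable_const finite_multi_indices) auto
qed

section \<open>Effect of the scaling on polynomial states\<close>

lemma scaled_components:
  "mass_density (scaled W U \<theta> x) = (1 - \<theta>) * mass_density W + \<theta> * mass_density (U x)"
  "momentum (scaled W U \<theta> x) $ i = (1 - \<theta>) * momentum W $ i + \<theta> * momentum (U x) $ i"
  "magnetic_field (scaled W U \<theta> x) $ i = (1 - \<theta>) * magnetic_field W $ i + \<theta> * magnetic_field (U x) $ i"
  "total_energy (scaled W U \<theta> x) = (1 - \<theta>) * total_energy W + \<theta> * total_energy (U x)"
  by (simp_all add: scaled_convex_combination state_simps)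

lemma scaled_in_poly_states:
  assumes "U \<in> poly_states k"
  shows "scaled W U \<theta> \<in> poly_states k"
  using assms unfolding poly_states_def
  by (simp add: scaled_components linear_combination_in_poly_space const_in_poly_space)

text \<open>For d > 1 the constant \<open>W\<close> drops out and the divergence is multiplied by
  \<theta>. For d = 1 the field is a combination of two values that both equal
  \<open>B\<^sub>0\<close>, whence the condition on \<open>W\<close> in that case.\<close>

lemma magnetic_constraint_scaled:
  fixes U :: "real^'d::finite \<Rightarrow> state"
  assumes U: "U \<in> poly_states k" and mc: "magnetic_constraint e B\<^sub>0 K U"
    and W: "CARD('d) = 1 \<Longrightarrow> magnetic_field W $ 1 = B\<^sub>0"
  shows "magnetic_constraint e B\<^sub>0 K (scaled W U \<theta>)"
proof (cases "CARD('d) = 1")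
  case True
  then show ?thesis
    using mc W by (auto simp: magnetic_constraint_def scaled_components algebra_simps)
next
  case False
  have "frechet_derivative (\<lambda>y. magnetic_field (scaled W U \<theta> y) $ j) (at x)
      = (\<lambda>h. \<theta> * frechet_derivative (\<lambda>y. magnetic_field (U y) $ j) (at x) h)" for j x
  proof -
    have "(\<lambda>y. magnetic_field (U y) $ j) differentiable (at x)"
      using U poly_space_differentiable unfolding poly_states_def by blast
    then have "((\<lambda>y. magnetic_field (U y) $ j) has_derivative
        frechet_derivative (\<lambda>y. magnetic_field (U y) $ j) (at x)) (at x)"
      by (simp add: frechet_derivative_works)
    then have "((\<lambda>y. magnetic_field (scaled W U \<theta> y) $ j) has_derivative
        (\<lambda>h. \<theta> * frechet_derivative (\<lambda>y. magnetic_field (U y) $ j) (at x) h)) (at x)"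
      unfolding scaled_components by (auto intro!: derivative_eq_intros)
    then show ?thesis
      by (rule frechet_derivative_at[symmetric])
  qed
  then show ?thesis
    using mc False by (simp add: magnetic_constraint_def flip: sum_distrib_left)
qed

section \<open>Combination of the positivity and entropy scalings\<close>

theorem theorem4p2:
  fixes \<gamma> B\<^sub>0 \<epsilon>\<^sub>\<rho> \<epsilon>\<^sub>p :: real
    and e :: "nat \<Rightarrow> 'd::finite"
    and K X :: "(real^'d) set"
    and k M N :: nat
    and f :: "nat \<Rightarrow> real \<Rightarrow> real"
    and \<omega> b :: "nat \<Rightarrow> real"
    and node :: "nat \<Rightarrow> real^'d"
    and U :: "real^'d \<Rightarrow> state"
    and W :: state
    and \<theta>\<^sub>K :: real
  assumes "\<gamma> > 1"
    and "CARD('d) \<in> {1, 2, 3}"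
    and "bij_betw e {1..CARD('d)} UNIV"
    and "M \<ge> 1"
    and "\<forall>r\<in>{1..M}. C2 (f r)"
    and "\<forall>r\<in>{1..M}. \<forall>z. deriv (f r) z > 0"
    and "\<forall>r\<in>{1..M}. \<forall>z. deriv (f r) z - \<gamma> * deriv (deriv (f r)) z > 0"
    and "is_cell K"
    and "\<forall>a\<in>{1..N}. node a \<in> K \<and> \<omega> a > 0"
    and "(\<Sum>a=1..N. \<omega> a) = 1"
    and "\<forall>V\<in>poly_states k. cell_average K V = (\<Sum>a=1..N. \<omega> a *\<^sub>R V (node a))"
    and "finite X" and "X \<subseteq> K" and "node ` {1..N} \<subseteq> X"
    and "U \<in> poly_states k"
    and "magnetic_constraint e B\<^sub>0 K U"
    and "W = cell_average K U"
    and "W \<in> admissible"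
    and "\<forall>r\<in>{1..M}. entropy \<gamma> (f r) W \<le> b r"
    and "0 < \<epsilon>\<^sub>\<rho>" and "\<epsilon>\<^sub>\<rho> < mass_density W"
    and "0 < \<epsilon>\<^sub>p" and "\<epsilon>\<^sub>p < pressure \<gamma> W"
    and "\<theta>\<^sub>K = theta_K \<gamma> M f N \<omega> node b \<epsilon>\<^sub>\<rho> \<epsilon>\<^sub>p X W U"
  shows "\<forall>\<theta>\<in>insert \<theta>\<^sub>K {0..<\<theta>\<^sub>K}.
      cell_average K (scaled W U \<theta>) = W
    \<and> (\<forall>x\<in>X. scaled W U \<theta> x \<in> admissible_eps \<gamma> \<epsilon>\<^sub>\<rho> \<epsilon>\<^sub>p)
    \<and> (\<forall>r\<in>{1..M}. quad_entropy \<gamma> (f r) N \<omega> node (scaled W U \<theta>) \<le> b r)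
    \<and> magnetic_constraint e B\<^sub>0 K (scaled W U \<theta>)"
proof -
  let ?G = "admissible_eps \<gamma> \<epsilon>\<^sub>\<rho> \<epsilon>\<^sub>p"
  have avg: "(\<Sum>a=1..N. \<omega> a *\<^sub>R U (node a)) = W"
    using assms(11,15,17) by simp
  have avg_scaled: "(\<Sum>a=1..N. \<omega> a *\<^sub>R scaled W U \<theta> (node a)) = W" for \<theta>
    using assms(10) avg by (rule scaled_average)
  \<comment> \<open>The scaled polynomial stays in the same space, so exactness of the quadrature
    reduces its cell average to a nodal sum.\<close>
  have cell: "cell_average K (scaled W U \<theta>) = W" for \<theta>
    using assms(11) scaled_in_poly_states[OF assms(15)] avg_scaled by simp
  have mag: "magnetic_constraint e B\<^sub>0 K (scaled W U \<theta>)" for \<theta>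
  proof (rule magnetic_constraint_scaled[OF assms(15,16)])
    \<comment> \<open>The nodes lie in \<open>K\<close>, so the first field component of
      \<open>W\<close> is a weighted mean of values equal to \<open>B\<^sub>0\<close>.\<close>
    assume "CARD('d) = 1"
    then have "magnetic_field (U (node a)) $ 1 = B\<^sub>0" if "a \<in> {1..N}" for a
      using assms(9,16) that by (simp add: magnetic_constraint_def)
    then have "(\<Sum>a=1..N. \<omega> a * magnetic_field (U (node a)) $ 1) = (\<Sum>a=1..N. \<omega> a) * B\<^sub>0"
      unfolding sum_distrib_right by (intro sum.cong) auto
    moreover have "magnetic_field W $ 1 = (\<Sum>a=1..N. \<omega> a * magnetic_field (U (node a)) $ 1)"
      by (simp add: avg[symmetric] linear_sum[OF magnetic_field_linear]
          linear_cmul[OF magnetic_field_linear])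
    ultimately show "magnetic_field W $ 1 = B\<^sub>0"
      using assms(10) by simp
  qed
  have W: "W \<in> ?G"
    using assms(18,21,23) by (simp add: admissible_eps_def)
  define \<tau> where "\<tau> = theta_PP \<gamma> \<epsilon>\<^sub>\<rho> \<epsilon>\<^sub>p X W U"
  define P where "P = scaled W U \<tau>"
  define \<phi> where "\<phi> = (\<lambda>r. entropy_scaling \<gamma> (f r) N \<omega> node (b r) W P)"
  define \<mu> where "\<mu> = (MIN r\<in>{1..M}. \<phi> r)"
  have \<tau>: "\<tau> \<in> {0..1}" and P: "\<And>x. x \<in> X \<Longrightarrow> P x \<in> ?G"
    using theta_PP_properties[OF assms(1,20,22) W, of X U] by (auto simp: \<tau>_def P_def)
  have \<phi>: "\<phi> r \<in> {0..1}"
    and bound: "\<And>t. t \<in> {0..\<phi> r} \<Longrightarrow> quad_entropy \<gamma> (f r) N \<omega> node (scaled W P t) \<le> b r"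
    if r: "r \<in> {1..M}" for r
  proof -
    have "\<forall>a\<in>{1..N}. P (node a) \<in> admissible"
      using P assms(14) by (auto simp: admissible_eps_def)
    moreover have "(\<Sum>a=1..N. \<omega> a *\<^sub>R P (node a)) = W"
      unfolding P_def by (rule avg_scaled)
    moreover have "\<forall>a\<in>{1..N}. \<omega> a > 0"
      using assms(9) by blast
    ultimately have *: "entropy_scaling \<gamma> (f r) N \<omega> node (b r) W P \<in> {0..1}"
      "\<And>t. t \<in> {0..entropy_scaling \<gamma> (f r) N \<omega> node (b r) W P} \<Longrightarrow>
        quad_entropy \<gamma> (f r) N \<omega> node (scaled W P t) \<le> b r"
      using entropy_scaling_properties[of "f r" \<gamma> N \<omega> P node W "b r"] assms(1,5-7,10,18,19) r
      by blast+
    show "\<phi> r \<in> {0..1}" using *(1) by (simp add: \<phi>_def)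
    show "quad_entropy \<gamma> (f r) N \<omega> node (scaled W P t) \<le> b r" if "t \<in> {0..\<phi> r}" for t
      using *(2) that by (simp add: \<phi>_def)
  qed
  have \<mu>_le: "\<mu> \<le> \<phi> r" if "r \<in> {1..M}" for r
    unfolding \<mu>_def using that by (intro Min_le) auto
  \<comment> \<open>The minimum over a nonempty finite set is attained and hence inherits the range
    of the \<open>\<phi> r\<close>.\<close>
  have "\<mu> \<in> \<phi> ` {1..M}"
    unfolding \<mu>_def using assms(4) by (intro Min_in) auto
  then have \<mu>: "\<mu> \<in> {0..1}" using \<phi> by auto
  have \<theta>\<^sub>K: "\<theta>\<^sub>K = \<tau> * \<mu>"
    unfolding assms(24) theta_K_def Let_def \<mu>_def \<phi>_def P_def \<tau>_def by (rule refl)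
  show ?thesis
  proof
    fix \<theta> assume "\<theta> \<in> insert \<theta>\<^sub>K {0..<\<theta>\<^sub>K}"
    then have \<theta>: "0 \<le> \<theta>" "\<theta> \<le> \<tau> * \<mu>"
      using \<tau> \<mu> by (auto simp: \<theta>\<^sub>K)
    \<comment> \<open>Every scalar in question is an entropy scaling by some
      \<open>t \<le> \<mu>\<close> of the positivity-scaled \<open>P\<close>. If
      \<open>\<tau> = 0\<close>, then \<open>\<theta> = 0\<close> and \<open>t = 0\<close>
      serves.\<close>
    obtain t where t: "t \<in> {0..\<mu>}" "\<theta> = \<tau> * t"
    proof (cases "\<tau> = 0")
      case True
      then show ?thesis using \<theta> \<mu> that[of 0] by simp
    next
      case False
      then show ?thesis using \<theta> \<tau> that[of "\<theta> / \<tau>"] by (auto simp: field_simps)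
    qed
    have scaled: "scaled W U \<theta> = scaled W P t"
      by (simp add: P_def scaled_scaled t(2))
    have "scaled W U \<theta> x \<in> ?G" if "x \<in> X" for x
      unfolding scaled using t(1) \<mu> W P[OF that]
      by (intro scaled_mem_convex convex_admissible_eps assms(1)) auto
    moreover have "quad_entropy \<gamma> (f r) N \<omega> node (scaled W U \<theta>) \<le> b r" if "r \<in> {1..M}" for r
      unfolding scaled using t(1) \<mu>_le[OF that] by (intro bound that) auto
    ultimately show "cell_average K (scaled W U \<theta>) = W
      \<and> (\<forall>x\<in>X. scaled W U \<theta> x \<in> ?G)
      \<and> (\<forall>r\<in>{1..M}. quad_entropy \<gamma> (f r) N \<omega> node (scaled W U \<theta>) \<le> b r)
      \<and> magnetic_constraint e B\<^sub>0 K (scaled W U \<theta>)"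
      using cell mag by blast
  qed
qed

end
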